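(* Let $d\geq 1$ be an integer, let $0<r<1$, and let $0<p,q<1$ be such that $\frac{1}{p}+\frac{1}{q}=\frac{\log_{2}(2^r+2)}{r}$. If $$\|f*g\|_{\ell^r(\mathbb{Z}^d)}\geq \|f\|_{\ell^p(\mathbb{Z}^d)}\,\|g\|_{\ell^q(\mathbb{Z}^d)}$$ holds for all $f,g:\mathbb{Z}^d\to [0,\infty)$ supported in $\{0,1\}^d$, then both $p$ and $q$ belong to the interval $$\left[\frac{1}{\frac{\log_2 (2^r+2)}{r}-\frac{1+2^{r-1}}{r+2^{r-1}}},\ \frac{r+2^{r-1}}{1+2^{r-1}}\right].$$
   Context: A function $f$ on $\mathbb{Z}^d$ is supported in $\{0,1\}^d$ if $f(x)=0$ for all $x\notin\{0,1\}^d$. Convolution: $(f*g)(x)=\sum_{y\in\mathbb{Z}^d} f(y)g(x-y)$. For every $0<p<\infty$ (including $p<1$), $\|f\|_{\ell^p(\mathbb{Z}^d)}=\big(\sum_{x\in\mathbb{Z}^d}|f(x)|^p\big)^{1/p}$. *)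

theory Defs
  imports "HOL-Analysis.Analysis"
begin

text \<open>
  The lattice \<open>\<int>\<^sup>d\<close> is the type \<open>int ^ 'd\<close>, with \<open>d = CARD('d) \<ge> 1\<close>.
  A sum \<open>\<Sum>\<^sub>\<infinity>\<close> that does not converge has the value 0, so the definitions of convolution and
  norm below have their usual meaning only for functions for which the sums converge; this includes
  all finitely supported functions (note that \<open>0 powr p = 0\<close>).
\<close>

definition supported_in :: "('a \<Rightarrow> real) \<Rightarrow> 'a set \<Rightarrow> bool" where
  "supported_in f A \<longleftrightarrow> (\<forall>x. x \<notin> A \<longrightarrow> f x = 0)"

definition cube01 :: "(int ^ 'd::finite) set" where
  "cube01 = {x. \<forall>i. x $ i \<in> {0, 1}}"

definition conv :: "(int ^ 'd::finite \<Rightarrow> real) \<Rightarrow> (int ^ 'd \<Rightarrow> real) \<Rightarrow> int ^ 'd \<Rightarrow> real" where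
  "conv f g = (\<lambda>x. \<Sum>\<^sub>\<infinity>y. f y * g (x - y))"

definition lp_norm :: "real \<Rightarrow> (int ^ 'd::finite \<Rightarrow> real) \<Rightarrow> real" where
  "lp_norm p f = (\<Sum>\<^sub>\<infinity>x. \<bar>f x\<bar> powr p) powr (1 / p)"

end

theory Submission
  imports Defs
begin

text \<open>
  The necessary condition is infinitesimal and already visible on two-point functions. Let \<open>e\<close> be
  a unit vector, \<open>f = \<delta>\<^sub>0 + a \<delta>\<^sub>e\<close> and \<open>g = \<delta>\<^sub>0 + b \<delta>\<^sub>e\<close>. Then \<open>f * g\<close> takes the values \<open>1\<close>,
  \<open>a + b\<close>, \<open>a b\<close>. The relation between the exponents says precisely that the convolution
  inequality is an equality at \<open>a = b = 1\<close>. Fixing \<open>b = 1\<close> and taking logarithms with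
  \<open>a = exp x\<close>, the function
    \<open>h x = ln (1 + (1 + exp x) powr r + exp (r x)) / r - ln (1 + exp (p x)) / p\<close>
  therefore has a global minimum at \<open>x = 0\<close>. Since \<open>h' 0 = 0\<close>, the content lies in \<open>h'' 0 \<ge> 0\<close>,
  which reads \<open>p \<le> (r + 2 powr (r - 1)) / (1 + 2 powr (r - 1))\<close>
  (lemma \<open>exponent_le_of_two_point_inequality\<close>). Exchanging the roles of \<open>f\<close> and \<open>g\<close> gives the same
  upper bound for \<open>q\<close>, and the relation between \<open>1 / p\<close> and \<open>1 / q\<close> turns each upper bound into
  the lower bound for the other exponent.
\<close>

section \<open>Two-point functions\<close>

text \<open>The function with value \<open>1\<close> at the origin, value \<open>a\<close> at \<open>e\<close>, and \<open>0\<close> elsewhere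
  (for \<open>e \<noteq> 0\<close>).\<close>
definition two_point :: "int ^ 'd::finite \<Rightarrow> real \<Rightarrow> int ^ 'd \<Rightarrow> real" where
  "two_point e a x = (if x = 0 then 1 else if x = e then a else 0)"

lemma two_point_nonneg: "0 \<le> a \<Longrightarrow> 0 \<le> two_point e a x"
  by (simp add: two_point_def)

lemma supported_in_two_point_axis: "supported_in (two_point (axis i 1) a) cube01"
  by (auto simp: supported_in_def two_point_def cube01_def axis_def)

lemma lp_norm_two_point:
  assumes "e \<noteq> 0" "0 < a"
  shows "lp_norm p (two_point e a) = (1 + a powr p) powr (1 / p)"
proof -
  have "(\<Sum>\<^sub>\<infinity>x. \<bar>two_point e a x\<bar> powr p) = (\<Sum>\<^sub>\<infinity>x\<in>{0, e}. \<bar>two_point e a x\<bar> powr p)"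
    by (rule infsum_cong_neutral) (auto simp: two_point_def)
  also have "\<dots> = 1 + a powr p"
    using assms by (simp add: two_point_def)
  finally show ?thesis
    by (simp add: lp_norm_def)
qed

lemma conv_two_point:
  assumes "e \<noteq> 0"
  shows "conv (two_point e a) g x = g x + a * g (x - e)"
proof -
  have "conv (two_point e a) g x = (\<Sum>\<^sub>\<infinity>y\<in>{0, e}. two_point e a y * g (x - y))"
    unfolding conv_def by (rule infsum_cong_neutral) (auto simp: two_point_def)
  also have "\<dots> = g x + a * g (x - e)"
    using assms by (simp add: two_point_def)
  finally show ?thesis .
qed

lemma lp_norm_conv_two_point:
  fixes e :: "int ^ 'd::finite"
  assumes e: "e \<noteq> 0" and "0 < a" "0 < b"
  shows "lp_norm r (conv (two_point e a) (two_point e b))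
       = (1 + (a + b) powr r + (a * b) powr r) powr (1 / r)"
proof -
  have e2: "e + e \<noteq> 0" "e + e \<noteq> e" "- e \<noteq> e"
    using e by (auto simp: vec_eq_iff)
  let ?F = "conv (two_point e a) (two_point e b)"
  have F: "?F x = two_point e b x + a * two_point e b (x - e)" for x
    using e by (rule conv_two_point)
  have zero: "?F x = 0" if "x \<notin> {0, e, e + e}" for x
    using that by (auto simp: F two_point_def algebra_simps)
  have "(\<Sum>\<^sub>\<infinity>x. \<bar>?F x\<bar> powr r) = (\<Sum>\<^sub>\<infinity>x\<in>{0, e, e + e}. \<bar>?F x\<bar> powr r)"
    by (rule infsum_cong_neutral) (auto simp: zero)
  also have "\<dots> = \<bar>?F 0\<bar> powr r + \<bar>?F e\<bar> powr r + \<bar>?F (e + e)\<bar> powr r"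
    using e e2 by (auto simp: add.assoc)
  also have "?F 0 = 1"
    using e e2 by (simp add: F two_point_def)
  also have "?F e = a + b"
    using e by (simp add: F two_point_def)
  also have "?F (e + e) = a * b"
    using e e2 by (simp add: F two_point_def)
  finally show ?thesis
    using assms by (simp add: lp_norm_def)
qed

section \<open>The second-order condition\<close>

lemma second_derivative_nonneg_at_min:
  fixes h h' :: "real \<Rightarrow> real"
  assumes min: "\<And>x. h x0 \<le> h x"
    and h: "\<And>x. (h has_real_derivative h' x) (at x)"
    and h': "(h' has_real_derivative D) (at x0)"
  shows "0 \<le> D"
proof (rule ccontr)
  assume "\<not> 0 \<le> D"
  have "h' x0 = 0"
    by (rule DERIV_local_min[OF h zero_less_one]) (use min in auto)
  with DERIV_neg_dec_right[OF h'] \<open>\<not> 0 \<le> D\<close>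
  obtain d where d: "d > 0" "\<And>t. 0 < t \<Longrightarrow> t < d \<Longrightarrow> h' (x0 + t) < 0"
    by auto
  obtain z where z: "x0 < z" "z < x0 + d / 2" "h (x0 + d / 2) - h x0 = (x0 + d / 2 - x0) * h' z"
    using MVT2[of x0 "x0 + d / 2" h h'] h d(1) by auto
  have "h' z < 0"
    using d(2)[of "z - x0"] z d(1) by auto
  then have "(x0 + d / 2 - x0) * h' z < 0"
    using d(1) by (simp add: mult_pos_neg)
  then have "h (x0 + d / 2) < h x0"
    using z(3) by linarith
  with min[of "x0 + d / 2"] show False by simp
qed

text \<open>The convolution inequality for the functions \<open>\<delta>\<^sub>0 + a \<delta>\<^sub>e\<close> and \<open>\<delta>\<^sub>0 + \<delta>\<^sub>e\<close> bounds the
  exponent \<open>p\<close> from above.\<close>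
lemma exponent_le_of_two_point_inequality:
  fixes p q r :: real
  assumes r: "0 < r" and p: "0 < p"
    and rel: "1 / p + 1 / q = log 2 (2 powr r + 2) / r"
    and ineq: "\<And>a. 0 < a \<Longrightarrow> (1 + a powr p) powr (1 / p) * 2 powr (1 / q)
                 \<le> (1 + (a + 1) powr r + a powr r) powr (1 / r)"
  shows "p \<le> (r + 2 powr (r - 1)) / (1 + 2 powr (r - 1))"
proof -
  define N where "N x = 1 + (1 + exp x) powr r + exp (r * x)" for x :: real
  define h where "h x = ln (N x) / r - ln (1 + exp (p * x)) / p" for x :: real
  define h' where "h' x = ((1 + exp x) powr (r - 1) * exp x + exp (r * x)) / N x
      - exp (p * x) / (1 + exp (p * x))" for x :: real
  \<comment> \<open>All second-order data at \<open>0\<close> are polynomial in \<open>r\<close> and \<open>c\<close>; in particular \<open>N 0 = 2 (1 + c)\<close>.\<close>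
  define c :: real where "c = 2 powr (r - 1)"
  have c: "0 < c"
    by (simp add: c_def)
  have two_r: "2 powr r = 2 * c" and two_r2: "2 powr (r - 2) = c / 2"
    by (simp_all add: c_def powr_diff)
  have N_pos: "0 < N x" for x
    by (simp add: N_def add_pos_nonneg)
  have E_pos: "0 < 1 + exp x" for x :: real
    by (simp add: add_pos_pos)
  have min: "h 0 \<le> h x" for x
  proof -
    have "ln ((1 + exp x powr p) powr (1 / p) * 2 powr (1 / q))
        \<le> ln ((1 + (exp x + 1) powr r + exp x powr r) powr (1 / r))"
      using ineq[of "exp x"] E_pos[of "p * x"]
      by (intro ln_mono) (auto simp: powr_def intro!: mult_pos_pos)
    moreover have "exp x powr s = exp (s * x)" for s
      by (simp add: powr_def)
    ultimately have "ln (1 + exp (p * x)) / p + ln 2 / q \<le> ln (N x) / r"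
      using E_pos[of "p * x"] N_pos[of x]
      by (simp add: ln_mult ln_powr N_def add.commute)
    \<comment> \<open>The relation between the exponents is equality in the convolution inequality at \<open>a = 1\<close>.\<close>
    moreover have "ln (N 0) / r - ln 2 / p = ln 2 / q"
    proof -
      have "ln (N 0) / r = ln 2 * (1 / p + 1 / q)"
        unfolding rel by (simp add: N_def log_def add.commute)
      then show ?thesis
        by (simp add: algebra_simps)
    qed
    ultimately show ?thesis
      by (simp add: h_def)
  qed
  have dN: "(N has_real_derivative r * ((1 + exp x) powr (r - 1) * exp x + exp (r * x))) (at x)"
    for x
    unfolding N_def using E_pos[of x]
    by (auto intro!: derivative_eq_intros simp: algebra_simps powr_diff)
  have dh: "(h has_real_derivative h' x) (at x)" for x
  proof -
    have "((\<lambda>x. ln (N x) / r - ln (1 + exp (p * x)) / p) has_real_derivative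
        r * ((1 + exp x) powr (r - 1) * exp x + exp (r * x)) / N x / r
        - p * exp (p * x) / (1 + exp (p * x)) / p) (at x)"
      using E_pos[of "p * x"] N_pos[of x] r p
      by (auto intro!: derivative_eq_intros dN)
    then show ?thesis
      unfolding h_def h'_def using r p by simp
  qed
  let ?D = "((((r + 1) * c + 2 * r) / (1 + c)) - r - p) / 4"
  have N0: "N 0 = 2 * (1 + c)"
    by (simp add: N_def two_r)
  have dh': "(h' has_real_derivative
      (((r - 1) * (c / 2) + c + r) * N 0 - (c + 1) * (r * (c + 1))) / (N 0 * N 0) - p / 4) (at 0)"
    unfolding h'_def using N_pos[of 0]
    by (auto intro!: derivative_eq_intros dN simp: two_r2 c_def[symmetric])
  also have "(((r - 1) * (c / 2) + c + r) * N 0 - (c + 1) * (r * (c + 1))) / (N 0 * N 0) - p / 4 = ?D"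
    unfolding N0 using c by (simp add: divide_simps) algebra
  finally have "0 \<le> ?D"
    by (rule second_derivative_nonneg_at_min[OF min dh])
  then have "p \<le> ((r + 1) * c + 2 * r) / (1 + c) - r"
    by simp
  also have "\<dots> = (r + c) / (1 + c)"
    using c by (simp add: field_simps)
  finally show ?thesis
    by (simp add: c_def)
qed

section \<open>The range of the exponents\<close>

text \<open>An upper bound \<open>U\<close> on one of two exponents with prescribed sum of reciprocals \<open>L\<close> is a lower
  bound on the other.\<close>
lemma exponent_ge_of_conjugate_le:
  fixes p q L U :: real
  assumes "0 < p" "0 < q" "1 / p + 1 / q = L" "q \<le> U"
  shows "1 / (L - 1 / U) \<le> p"
proof -
  have "1 / U \<le> 1 / q"
    using assms by (simp add: frac_le)
  then have "1 / p \<le> L - 1 / U"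
    using assms(3) by linarith
  then have "1 / (L - 1 / U) \<le> 1 / (1 / p)"
    using assms(1) by (intro divide_left_mono) (auto intro!: divide_pos_pos elim: less_le_trans[rotated])
  then show ?thesis by simp
qed

theorem proposition1p9:
  fixes p q r :: real
  assumes "0 < r" and "r < 1"
    and "0 < p" and "p < 1" and "0 < q" and "q < 1"
    and "1 / p + 1 / q = log 2 (2 powr r + 2) / r"
    and "\<And>f g :: int ^ 'd::finite \<Rightarrow> real.
           (\<And>x. 0 \<le> f x) \<Longrightarrow> (\<And>x. 0 \<le> g x) \<Longrightarrow>
           supported_in f cube01 \<Longrightarrow> supported_in g cube01 \<Longrightarrow>
           lp_norm r (conv f g) \<ge> lp_norm p f * lp_norm q g"
  shows "p \<in> {1 / (log 2 (2 powr r + 2) / r - (1 + 2 powr (r - 1)) / (r + 2 powr (r - 1))) ..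
              (r + 2 powr (r - 1)) / (1 + 2 powr (r - 1))} \<and>
         q \<in> {1 / (log 2 (2 powr r + 2) / r - (1 + 2 powr (r - 1)) / (r + 2 powr (r - 1))) ..
              (r + 2 powr (r - 1)) / (1 + 2 powr (r - 1))}"
proof -
  define e :: "int ^ 'd" where "e = axis undefined 1"
  define U where "U = (r + 2 powr (r - 1)) / (1 + 2 powr (r - 1))"
  have e: "e \<noteq> 0"
    by (simp add: e_def axis_eq_0_iff)
  have supp: "supported_in (two_point e a) cube01" for a
    unfolding e_def by (rule supported_in_two_point_axis)
  have ineq: "(1 + a powr p) powr (1 / p) * (1 + b powr q) powr (1 / q)
      \<le> (1 + (a + b) powr r + (a * b) powr r) powr (1 / r)" if "0 < a" "0 < b" for a b
    using assms(8)[of "two_point e a" "two_point e b"] that e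
    by (simp add: two_point_nonneg lp_norm_two_point lp_norm_conv_two_point supp)
  have p: "p \<le> U"
    unfolding U_def using ineq[of _ 1] assms
    by (intro exponent_le_of_two_point_inequality[of r p q]) auto
  have q: "q \<le> U"
    unfolding U_def using ineq[of 1] assms
    by (intro exponent_le_of_two_point_inequality[of r q p]) (auto simp: add.commute mult.commute)
  have "1 / (log 2 (2 powr r + 2) / r - 1 / U) \<le> p"
    using exponent_ge_of_conjugate_le[OF _ _ _ q] assms by blast
  moreover have "1 / (log 2 (2 powr r + 2) / r - 1 / U) \<le> q"
    using exponent_ge_of_conjugate_le[OF _ _ _ p] assms by (simp add: add.commute)
  moreover have "1 / U = (1 + 2 powr (r - 1)) / (r + 2 powr (r - 1))"
    by (simp add: U_def)
  ultimately show ?thesis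
    using p q by (simp add: U_def)
qed

end
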